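(* Let $X_i$, $i \ge 1$, be independent and identically distributed random variables supported on $(0,\infty)$, and for $n\ge 1$ let $S_n = \sum_{i=1}^n X_i$ and $M_n = \max_{1\le i\le n} X_i$. Assume that $X_1$ has a strictly positive density $f$ supported on $(0,\infty)$ and that there exist four positive constants $c_1, c_2, \alpha, \beta$ such that $$\lim_{x\to +0}\frac{f(x)}{x^{\alpha-1}} = c_1 \qquad\text{and}\qquad \lim_{x\to\infty}\frac{-\log f(x)}{x^{\beta}} = c_2 .$$ Assume that $n\ge 2$ is an integer and $$\beta < \frac{\log n}{\log n + h(\alpha) - h(n\alpha)},$$ where $h(x) = \frac{\log\Gamma(x+1)}{x}$ for $x>0$. Then there is no constant $C$ such that $S_n = C M_n$ in distribution.
   Context: $\Gamma$ is the gamma function. "Strictly positive density supported on $(0,\infty)$" means that the law of $X_1$ is absolutely continuous with density $f$ satisfying $f(x)>0$ for every $x>0$ and $f$ vanishing outside $(0,\infty)$. Equality in distribution means equality of laws. *)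

theory Defs
  imports "HOL-Probability.Probability"
begin

definition h_fun :: "real \<Rightarrow> real" where
  "h_fun x = ln (Gamma (x + 1)) / x"

end

theory Submission
  imports Defs "HOL-Real_Asymp.Real_Asymp"
begin

text \<open>
  Suppose \<open>S\<^sub>n = C M\<^sub>n\<close> in distribution. Then \<open>C > 1\<close>, because \<open>S\<^sub>n > M\<^sub>n\<close>. Near \<open>0\<close>, comparing
  \<open>P(S\<^sub>n \<le> x)\<close>, which a Dirichlet integral bounds from above, with \<open>P(X\<^sub>1 \<le> x / C)\<^sup>n\<close> yields
  \<open>ln C \<ge> h(n\<alpha>) - h(\<alpha>)\<close>. At infinity, put \<open>q = min(1, n powr (1 - \<beta>))\<close>, so that
  \<open>\<Sum> x\<^sub>i powr \<beta> \<ge> q (\<Sum> x\<^sub>i) powr \<beta>\<close>; a Chernoff bound for \<open>\<Sum> X\<^sub>i powr \<beta>\<close> then shows that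
  \<open>- ln P(S\<^sub>n > x)\<close> is at least asymptotically \<open>c\<^sub>2 q x powr \<beta>\<close>, whereas
  \<open>P(C M\<^sub>n > x) \<ge> P(X\<^sub>1 > x / C)\<close> makes it at most asymptotically \<open>c\<^sub>2 (x / C) powr \<beta>\<close>.
  Hence \<open>q \<le> C powr (-\<beta>)\<close>, which contradicts \<open>C > 1\<close> if \<open>\<beta> < 1\<close> and the lower bound for
  \<open>ln C\<close> if \<open>\<beta> \<ge> 1\<close>.
\<close>

section \<open>Power sums compared with powers of sums\<close>

text \<open>Each \<open>x i\<close> is at most the sum \<open>S\<close>, and the exponent
  \<open>p - 1\<close> is nonpositive, so \<open>S powr (p - 1)\<close> is at most
  \<open>x i powr (p - 1)\<close>. Multiplying by \<open>x i\<close> and summing gives the claim. It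
  supplies the constant \<open>q = 1\<close> when \<beta> < 1.\<close>

lemma powr_sum_le_sum_powr:
  fixes x :: "'i \<Rightarrow> real"
  assumes "finite I" "I \<noteq> {}" "\<And>i. i \<in> I \<Longrightarrow> x i > 0" "0 \<le> p" "p \<le> 1"
  shows "(\<Sum>i\<in>I. x i) powr p \<le> (\<Sum>i\<in>I. x i powr p)"
proof -
  define S where "S = (\<Sum>i\<in>I. x i)"
  have "S > 0" unfolding S_def using assms by (intro sum_pos) auto
  have "x i * S powr (p - 1) \<le> x i powr p" if "i \<in> I" for i
  proof -
    have "x i \<le> S" unfolding S_def using assms that by (intro member_le_sum) (auto intro: less_imp_le)
    hence "S powr (p - 1) \<le> x i powr (p - 1)" using assms that by (intro powr_mono2') auto
    hence "x i * S powr (p - 1) \<le> x i * x i powr (p - 1)"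
      using assms(3)[OF that] by (intro mult_left_mono) auto
    also have "\<dots> = x i powr p" using assms(3)[OF that] by (simp add: powr_diff)
    finally show ?thesis .
  qed
  hence "S * S powr (p - 1) \<le> (\<Sum>i\<in>I. x i powr p)"
    unfolding S_def sum_distrib_right by (intro sum_mono)
  moreover have "S * S powr (p - 1) = S powr p" using \<open>S > 0\<close> by (simp add: powr_diff)
  ultimately show ?thesis by (simp add: S_def)
qed

text \<open>Jensen's inequality for the convex function \<open>t powr p\<close> with equal weights
  \<open>1 / card I\<close>. It supplies the constant \<open>q\<close> when \<beta> \<ge> 1, with
  equality if all \<open>x i\<close> coincide.\<close>

lemma card_powr_mult_powr_sum_le_sum_powr:
  fixes x :: "'i \<Rightarrow> real"
  assumes "finite I" "I \<noteq> {}" "\<And>i. i \<in> I \<Longrightarrow> x i > 0" "1 \<le> p"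
  shows "real (card I) powr (1 - p) * (\<Sum>i\<in>I. x i) powr p \<le> (\<Sum>i\<in>I. x i powr p)"
proof -
  define m where "m = real (card I)"
  have "m > 0" unfolding m_def using assms by (simp add: card_gt_0_iff)
  have "(\<Sum>i\<in>I. (1 / m) *\<^sub>R x i) powr p \<le> (\<Sum>i\<in>I. 1 / m * (x i powr p))"
    using assms \<open>m > 0\<close>
    by (intro convex_on_sum[OF assms(1,2) powr_convex]) (auto simp: m_def)
  also have "(\<Sum>i\<in>I. (1 / m) *\<^sub>R x i) = (\<Sum>i\<in>I. x i) / m"
    by (simp add: sum_divide_distrib)
  also have "(\<Sum>i\<in>I. 1 / m * (x i powr p)) = (\<Sum>i\<in>I. x i powr p) / m"
    by (simp add: sum_divide_distrib)
  finally have "((\<Sum>i\<in>I. x i) powr p / m powr p) * m \<le> (\<Sum>i\<in>I. x i powr p)"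
    using \<open>m > 0\<close> assms(3)
    by (subst (asm) powr_divide) (auto simp: field_simps intro!: sum_nonneg less_imp_le)
  thus ?thesis using \<open>m > 0\<close> by (simp add: powr_diff m_def mult_ac)
qed

section \<open>Small values of the sum: a Dirichlet integral by iterated convolution\<close>

lemma nn_integral_powr_from_0:
  fixes a x :: real
  assumes "a > 0" "x > 0"
  shows "(\<integral>\<^sup>+y. ennreal (y powr (a - 1)) * indicator {0..x} y \<partial>lborel) = ennreal (x powr a / a)"
proof -
  have "((\<lambda>y. y powr (a - 1)) has_integral (x powr a / a)) {0..x}"
    using has_integral_powr_from_0[of "a - 1" x] assms by simp
  hence "((\<lambda>y. y powr (a - 1) * indicator {0..x} y) has_integral (x powr a / a)) UNIV"
    by (subst (asm) has_integral_restrict_UNIV[symmetric])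
       (erule has_integral_eq[rotated], simp add: indicator_def)
  from nn_integral_has_integral_lborel[OF _ _ this]
  have "(\<integral>\<^sup>+y. ennreal (y powr (a - 1) * indicator {0..x} y) \<partial>lborel) = ennreal (x powr a / a)"
    by simp
  thus ?thesis by (simp add: ennreal_mult' ennreal_indicator)
qed

text \<open>The substitution \<open>y = x * t\<close> reduces this to the Beta integral on the unit
  interval. It evaluates the convolution in the induction step of
  \<open>emeasure_sum_le_powr\<close>.\<close>

lemma nn_integral_Beta_scaled:
  fixes a b x :: real
  assumes "a > 0" "b > 0" "x > 0"
  shows "(\<integral>\<^sup>+y. ennreal (y powr (a - 1) * (x - y) powr (b - 1)) * indicator {0..x} y \<partial>lborel)
         = ennreal (x powr (a + b - 1) * Beta a b)"
proof -
  have "((\<lambda>t. t powr (a - 1) * (1 - t) powr (b - 1) * indicator {0..1} t) has_integral Beta a b) UNIV"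
    using has_integral_Beta_real[OF assms(1,2)]
    by (subst (asm) has_integral_restrict_UNIV[symmetric])
       (erule has_integral_eq[rotated], simp add: indicator_def)
  from nn_integral_has_integral_lborel[OF _ _ this]
  have *: "(\<integral>\<^sup>+t. ennreal (t powr (a - 1) * (1 - t) powr (b - 1) * indicator {0..1} t) \<partial>lborel)
     = ennreal (Beta a b)" by simp
  have "(\<integral>\<^sup>+y. ennreal (y powr (a - 1) * (x - y) powr (b - 1)) * indicator {0..x} y \<partial>lborel)
    = ennreal x * (\<integral>\<^sup>+t. ennreal ((x * t) powr (a - 1) * (x - x * t) powr (b - 1))
        * indicator {0..x} (x * t) \<partial>lborel)"
    using assms by (subst nn_integral_real_affine[of _ x 0]) auto
  also have "(\<integral>\<^sup>+t. ennreal ((x * t) powr (a - 1) * (x - x * t) powr (b - 1))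
        * indicator {0..x} (x * t) \<partial>lborel)
     = (\<integral>\<^sup>+t. ennreal (x powr (a - 1) * x powr (b - 1)) *
        ennreal (t powr (a - 1) * (1 - t) powr (b - 1) * indicator {0..1} t) \<partial>lborel)"
  proof (intro nn_integral_cong)
    fix t :: real
    show "ennreal ((x * t) powr (a - 1) * (x - x * t) powr (b - 1)) * indicator {0..x} (x * t)
      = ennreal (x powr (a - 1) * x powr (b - 1)) *
        ennreal (t powr (a - 1) * (1 - t) powr (b - 1) * indicator {0..1} t)"
    proof (cases "0 \<le> t \<and> t \<le> 1")
      case True
      have "x - x * t = x * (1 - t)" by (simp add: algebra_simps)
      hence "(x * t) powr (a - 1) * (x - x * t) powr (b - 1) =
         (x powr (a - 1) * x powr (b - 1)) * (t powr (a - 1) * (1 - t) powr (b - 1))"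
        using True assms by (simp add: powr_mult)
      thus ?thesis using True assms by (simp add: ennreal_mult' mult_left_le)
    qed (use assms in \<open>auto simp: indicator_def mult_le_0_iff zero_le_mult_iff\<close>)
  qed
  also have "\<dots> = ennreal (x powr (a - 1) * x powr (b - 1)) * ennreal (Beta a b)"
    by (subst nn_integral_cmult) (auto simp: *)
  also have "ennreal x * \<dots> = ennreal (x * (x powr (a - 1) * x powr (b - 1)) * Beta a b)"
    using assms by (simp add: ennreal_mult' mult.assoc)
  also have "x * (x powr (a - 1) * x powr (b - 1)) = x powr (1 + (a - 1) + (b - 1))"
    using assms by (simp only: powr_add) simp
  also have "1 + (a - 1) + (b - 1) = a + b - 1" by simp
  finally show ?thesis .
qed

text \<open>Independence makes the joint law a product measure, and Fubini integrates over the value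
  of \<open>X\<close>. As \<open>Y\<close> enters only through its distribution function, partial
  sums can take its place without their densities being computed.\<close>

lemma (in prob_space) emeasure_indep_add_le:
  fixes X Y :: "'a \<Rightarrow> real"
  assumes "indep_var borel X borel Y" and X: "distr M borel X = density lborel g"
    and [measurable]: "g \<in> borel_measurable borel"
  shows "emeasure M {\<omega>\<in>space M. X \<omega> + Y \<omega> \<le> x} =
     (\<integral>\<^sup>+y. g y * emeasure M {\<omega>\<in>space M. Y \<omega> \<le> x - y} \<partial>lborel)"
proof -
  have [measurable]: "X \<in> borel_measurable M" "Y \<in> borel_measurable M"
    and eq: "distr M borel X \<Otimes>\<^sub>M distr M borel Y = distr M (borel \<Otimes>\<^sub>M borel) (\<lambda>\<omega>. (X \<omega>, Y \<omega>))"
    using assms(1) by (auto simp: indep_var_distribution_eq)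
  interpret Y: prob_space "distr M borel Y" by (rule prob_space_distr) simp
  let ?A = "{z \<in> space (borel \<Otimes>\<^sub>M borel). fst z + snd z \<le> (x::real)}"
  have A[measurable]: "?A \<in> sets (borel \<Otimes>\<^sub>M borel)" by measurable
  have "emeasure M {\<omega>\<in>space M. X \<omega> + Y \<omega> \<le> x} = 
      emeasure (distr M (borel \<Otimes>\<^sub>M borel) (\<lambda>\<omega>. (X \<omega>, Y \<omega>))) ?A"
    using A by (subst emeasure_distr) (auto simp: space_pair_measure intro!: arg_cong[where f = "emeasure M"])
  also have "\<dots> = (\<integral>\<^sup>+y. emeasure (distr M borel Y) (Pair y -` ?A) \<partial>distr M borel X)"
    unfolding eq[symmetric] by (intro Y.emeasure_pair_measure_alt) simp
  also have "\<dots> = (\<integral>\<^sup>+y. emeasure M {\<omega>\<in>space M. Y \<omega> \<le> x - y} \<partial>distr M borel X)"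
    by (intro nn_integral_cong, subst emeasure_distr)
       (auto simp: space_pair_measure algebra_simps intro!: arg_cong[where f = "emeasure M"])
  also have "\<dots> = (\<integral>\<^sup>+y. g y * emeasure M {\<omega>\<in>space M. Y \<omega> \<le> x - y} \<partial>lborel)"
    unfolding X by (subst nn_integral_density) auto
  finally show ?thesis .
qed

text \<open>Induction on the number of summands. A new summand convolves the bound for
  \<open>k\<close> summands with \<open>a * y powr (\<alpha> - 1)\<close>, which produces the factor
  \<open>Beta \<alpha> (k * \<alpha> + 1)\<close>, and the Gamma factors telescope. The bound on
  \<open>f\<close> near 0 suffices because positive summands with sum at most \<open>x\<close> are
  themselves at most \<open>x\<close>.\<close>

lemma (in prob_space) emeasure_sum_le_powr:
  fixes X :: "'i \<Rightarrow> 'a \<Rightarrow> real" and f :: "real \<Rightarrow> real"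
  assumes "finite I" "indep_vars (\<lambda>_. borel) X I"
    and "\<And>i. i \<in> I \<Longrightarrow> distr M borel (X i) = density lborel (\<lambda>x. ennreal (f x))"
    and "\<And>i. i \<in> I \<Longrightarrow> AE \<omega> in M. X i \<omega> > 0"
    and f[measurable]: "(\<lambda>x. ennreal (f x)) \<in> borel_measurable borel"
    and f_zero: "\<And>x. x \<le> 0 \<Longrightarrow> f x = 0"
    and f_le: "\<And>x. 0 < x \<Longrightarrow> x \<le> \<delta> \<Longrightarrow> f x \<le> a * x powr (\<alpha> - 1)"
    and "a > 0" "\<alpha> > 0" "0 < x" "x \<le> \<delta>"
  shows "emeasure M {\<omega>\<in>space M. (\<Sum>i\<in>I. X i \<omega>) \<le> x}
    \<le> ennreal ((a * Gamma \<alpha>) ^ card I / Gamma (real (card I) * \<alpha> + 1) * x powr (real (card I) * \<alpha>))"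
  using assms(1-4) \<open>0 < x\<close> \<open>x \<le> \<delta>\<close>
proof (induction I arbitrary: x rule: finite_induct)
  case empty
  thus ?case by (simp add: emeasure_space_1)
next
  case (insert i I x)
  define k where "k = real (card I)"
  define A where "A = (a * Gamma \<alpha>) ^ card I / Gamma (k * \<alpha> + 1)"
  define G where "G = (\<lambda>x. emeasure M {\<omega>\<in>space M. (\<Sum>i\<in>I. X i \<omega>) \<le> x})"
  have k: "k \<ge> 0" by (simp add: k_def)
  have Gam: "Gamma \<alpha> > 0" "Gamma (k * \<alpha> + 1) > 0"
    using k \<open>\<alpha> > 0\<close> by (auto intro!: Gamma_real_pos add_nonneg_pos)
  have "A \<ge> 0" using Gam \<open>a > 0\<close> by (auto simp: A_def)
  have G_le: "G y \<le> ennreal (A * y powr (k * \<alpha>))" if "0 < y" "y \<le> \<delta>" for y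
    unfolding G_def A_def k_def
    using insert.prems that by (intro insert.IH) (auto intro: indep_vars_subset)
  have [measurable]: "X j \<in> borel_measurable M" if "j \<in> I" for j
    using insert.prems(1) that by (auto simp: indep_vars_def2)
  \<comment> \<open>This cuts the convolution off at \<open>y = x\<close>.\<close>
  have G_neg: "G y = 0" if "y < 0" for y
  proof -
    have "AE \<omega> in M. \<forall>j\<in>I. X j \<omega> > 0"
      using insert by (intro AE_finite_allI) auto
    hence "AE \<omega> in M. \<not> (\<Sum>i\<in>I. X i \<omega>) \<le> y"
    proof eventually_elim
      case (elim \<omega>)
      hence "(\<Sum>i\<in>I. X i \<omega>) \<ge> 0" by (intro sum_nonneg) (auto intro: less_imp_le)
      thus ?case using that by simp
    qed
    hence "emeasure M {\<omega>\<in>space M. \<not> \<not> (\<Sum>i\<in>I. X i \<omega>) \<le> y} = 0"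
      by (subst (asm) AE_iff_measurable[OF _ refl]) auto
    thus ?thesis by (simp add: G_def)
  qed
  have "emeasure M {\<omega>\<in>space M. (\<Sum>j\<in>insert i I. X j \<omega>) \<le> x} =
        emeasure M {\<omega>\<in>space M. X i \<omega> + (\<Sum>j\<in>I. X j \<omega>) \<le> x}"
    using insert by simp
  also have "\<dots> = (\<integral>\<^sup>+y. ennreal (f y) * G (x - y) \<partial>lborel)"
    unfolding G_def using insert
    by (intro emeasure_indep_add_le indep_vars_sum f) auto
  \<comment> \<open>The exponent \<open>k * \<alpha>\<close> is written as
    \<open>(k * \<alpha> + 1) - 1\<close> to fit the second parameter of the Beta integral.\<close>
  also have "\<dots> \<le> (\<integral>\<^sup>+y. ennreal (a * A) *
     (ennreal (y powr (\<alpha> - 1) * (x - y) powr ((k * \<alpha> + 1) - 1)) * indicator {0..x} y) \<partial>lborel)"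
  \<comment> \<open>The null set \<open>y = x\<close> is left out: there the right-hand side is 0,
    since \<open>0 powr _ = 0\<close>, while \<open>G 0 = 1\<close> if \<open>I\<close> is
    empty.\<close>
  proof (rule nn_integral_mono_AE, use AE_lborel_singleton[of x] in eventually_elim)
    fix y :: real assume "y \<noteq> x"
    consider "y \<le> 0" | "y > x" | "0 < y" "y < x" using \<open>y \<noteq> x\<close> by linarith
    thus "ennreal (f y) * G (x - y) \<le> ennreal (a * A) *
     (ennreal (y powr (\<alpha> - 1) * (x - y) powr ((k * \<alpha> + 1) - 1)) * indicator {0..x} y)"
    proof cases
      case 3
      have "ennreal (f y) * G (x - y) \<le> ennreal (a * y powr (\<alpha> - 1)) * ennreal (A * (x - y) powr (k * \<alpha>))"
        using 3 insert.prems by (intro mult_mono G_le ennreal_leI f_le) auto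
      also have "\<dots> = ennreal (a * A) * ennreal (y powr (\<alpha> - 1) * (x - y) powr ((k * \<alpha> + 1) - 1))"
        using \<open>a > 0\<close> \<open>A \<ge> 0\<close> by (simp flip: ennreal_mult' add: mult_ac)
      finally show ?thesis using 3 by simp
    qed (auto simp: f_zero G_neg)
  qed
  also have "\<dots> = ennreal (a * A) * ennreal (x powr (\<alpha> + (k * \<alpha> + 1) - 1) * Beta \<alpha> (k * \<alpha> + 1))"
    using \<open>\<alpha> > 0\<close> k insert.prems 
    by (subst nn_integral_cmult, simp, subst nn_integral_Beta_scaled) (auto intro: add_nonneg_pos)
  also have "\<dots> = ennreal (a * A * Beta \<alpha> (k * \<alpha> + 1) * x powr ((k + 1) * \<alpha>))"
    using \<open>a > 0\<close> \<open>A \<ge> 0\<close> by (simp flip: ennreal_mult' add: algebra_simps)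
  also have "a * A * Beta \<alpha> (k * \<alpha> + 1) = (a * Gamma \<alpha>) ^ Suc (card I) / Gamma ((k + 1) * \<alpha> + 1)"
    using Gam by (simp add: A_def Beta_def algebra_simps)
  also have "k + 1 = real (card (insert i I))" using insert by (simp add: k_def)
  also have "Suc (card I) = card (insert i I)" using insert by simp
  finally show ?case .
qed

section \<open>Large values: exponential moments and the Chernoff bound\<close>

text \<open>Markov's inequality for the exponential of the sum, whose expectation factorizes by
  independence. Nonnegative integrals allow this before the moments are known to be finite.\<close>

lemma (in prob_space) emeasure_sum_ge_le_exp:
  fixes Y :: "'i \<Rightarrow> 'a \<Rightarrow> real"
  assumes "finite I" "indep_vars (\<lambda>_. borel) Y I" and "s > 0"
  shows "emeasure M {\<omega>\<in>space M. (\<Sum>i\<in>I. Y i \<omega>) \<ge> t}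
    \<le> ennreal (exp (- s * t)) * (\<Prod>i\<in>I. \<integral>\<^sup>+\<omega>. ennreal (exp (s * Y i \<omega>)) \<partial>M)"
proof -
  have [measurable]: "Y j \<in> borel_measurable M" if "j \<in> I" for j
    using assms(2) that by (auto simp: indep_vars_def2)
  have "emeasure M {\<omega>\<in>space M. (\<Sum>i\<in>I. Y i \<omega>) \<ge> t}
     \<le> ennreal (exp (- s * t)) * (\<integral>\<^sup>+\<omega>. ennreal (exp (s * (\<Sum>i\<in>I. Y i \<omega>))) * indicator (space M) \<omega> \<partial>M)"
    by (intro Chernoff_ineq_nn_integral_ge assms) auto
  also have "(\<integral>\<^sup>+\<omega>. ennreal (exp (s * (\<Sum>i\<in>I. Y i \<omega>))) * indicator (space M) \<omega> \<partial>M) =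
     (\<integral>\<^sup>+\<omega>. (\<Prod>i\<in>I. ennreal (exp (s * Y i \<omega>))) \<partial>M)"
    by (intro nn_integral_cong) (simp add: sum_distrib_left exp_sum assms(1) prod_ennreal)
  also have "(\<integral>\<^sup>+\<omega>. (\<Prod>i\<in>I. ennreal (exp (s * Y i \<omega>))) \<partial>M) =
     (\<Prod>i\<in>I. \<integral>\<^sup>+\<omega>. ennreal (exp (s * Y i \<omega>)) \<partial>M)"
    by (intro indep_vars_nn_integral assms indep_vars_compose2[OF assms(2)]) auto
  finally show ?thesis .
qed

text \<open>Far out, the integrand is at most \<open>exp (- (c - s) * x powr \<beta>)\<close>, hence
  at most \<open>x powr (-2)\<close>. Before that, the exponential factor is bounded and
  \<open>f\<close> has finite integral.\<close>

lemma nn_integral_exp_powr_less_top: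
  fixes f :: "real \<Rightarrow> real"
  assumes f[measurable]: "(\<lambda>x. ennreal (f x)) \<in> borel_measurable borel"
    and "(\<integral>\<^sup>+x. ennreal (f x) \<partial>lborel) < \<infinity>"
    and f_zero: "\<And>x. x \<le> 0 \<Longrightarrow> f x = 0"
    and tail: "eventually (\<lambda>x. f x \<le> exp (- c * x powr \<beta>)) at_top"
    and "0 \<le> s" "s < c" "\<beta> > 0"
  shows "(\<integral>\<^sup>+x. ennreal (f x) * ennreal (exp (s * x powr \<beta>)) \<partial>lborel) < \<infinity>"
proof -
  have "eventually (\<lambda>x. exp (- (c - s) * x powr \<beta>) \<le> x powr (-2)) at_top"
    using \<open>s < c\<close> \<open>\<beta> > 0\<close> by real_asymp
  with tail have "eventually (\<lambda>x. f x * exp (s * x powr \<beta>) \<le> x powr (-2)) at_top"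
  proof eventually_elim
    case (elim x)
    have "f x * exp (s * x powr \<beta>) \<le> exp (- c * x powr \<beta>) * exp (s * x powr \<beta>)"
      using elim by (intro mult_right_mono) auto
    also have "\<dots> = exp (- (c - s) * x powr \<beta>)" by (simp flip: exp_add add: algebra_simps)
    finally show ?case using elim by simp
  qed
  then obtain b where b: "\<And>x. x \<ge> b \<Longrightarrow> f x * exp (s * x powr \<beta>) \<le> x powr (-2)"
    by (auto simp: eventually_at_top_linorder)
  \<comment> \<open>The cut-off must be positive for \<open>x powr (-2)\<close> to have a finite
    integral beyond it.\<close>
  define b' where "b' = max b 1"
  have "((\<lambda>x::real. x powr (-2)) has_integral (1 / b')) {b'..}"
    using has_integral_powr_to_inf[of "-2" b'] by (simp add: b'_def powr_minus_divide)
  hence "((\<lambda>x::real. x powr (-2) * indicator {b'..} x) has_integral (1 / b')) UNIV"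
    by (subst (asm) has_integral_restrict_UNIV[symmetric])
       (erule has_integral_eq[rotated], simp add: indicator_def)
  from nn_integral_has_integral_lborel[OF _ _ this]
  have int: "(\<integral>\<^sup>+x. ennreal (x powr (-2) * indicator {b'..} x) \<partial>lborel) = ennreal (1 / b')" by simp
  have "(\<integral>\<^sup>+x. ennreal (f x) * ennreal (exp (s * x powr \<beta>)) \<partial>lborel)
     \<le> (\<integral>\<^sup>+x. ennreal (exp (s * b' powr \<beta>)) * ennreal (f x) + ennreal (x powr (-2) * indicator {b'..} x) \<partial>lborel)"
  proof (rule nn_integral_mono)
    fix x :: real
    consider "x \<le> 0" | "0 < x" "x < b'" | "x \<ge> b'" by linarith
    thus "ennreal (f x) * ennreal (exp (s * x powr \<beta>))
      \<le> ennreal (exp (s * b' powr \<beta>)) * ennreal (f x) + ennreal (x powr (-2) * indicator {b'..} x)"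
    proof cases
      case 2
      hence "exp (s * x powr \<beta>) \<le> exp (s * b' powr \<beta>)"
        using \<open>0 \<le> s\<close> \<open>\<beta> > 0\<close> by (auto intro!: mult_left_mono powr_mono2)
      hence "ennreal (f x) * ennreal (exp (s * x powr \<beta>)) \<le> ennreal (f x) * ennreal (exp (s * b' powr \<beta>))"
        by (intro mult_left_mono ennreal_leI) auto
      thus ?thesis using 2 by (simp add: mult.commute)
    next
      case 3
      have "ennreal (f x) * ennreal (exp (s * x powr \<beta>)) = ennreal (f x * exp (s * x powr \<beta>))"
        by (simp add: ennreal_mult'')
      also have "\<dots> \<le> ennreal (x powr (-2))"
        using 3 b[of x] by (intro ennreal_leI) (simp add: b'_def)
      finally show ?thesis using 3 by (simp add: add_increasing)
    qed (simp add: f_zero)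
  qed
  also have "\<dots> = ennreal (exp (s * b' powr \<beta>)) * (\<integral>\<^sup>+x. ennreal (f x) \<partial>lborel) + ennreal (1 / b')"
    by (simp add: nn_integral_add nn_integral_cmult int)
  also have "\<dots> < \<infinity>"
    using assms(2) by (simp add: ennreal_mult_less_top)
  finally show ?thesis .
qed

section \<open>Lower bounds for the law of a single variable\<close>

lemma emeasure_density_Ioc_pos:
  fixes f :: "real \<Rightarrow> real"
  assumes [measurable]: "(\<lambda>x. ennreal (f x)) \<in> borel_measurable borel"
    and pos: "\<And>x. a < x \<Longrightarrow> f x > 0" and "a < b"
  shows "emeasure (density lborel (\<lambda>x. ennreal (f x))) {a<..b} > 0"
proof (rule ccontr)
  assume "\<not> ?thesis"
  hence "(\<integral>\<^sup>+x. ennreal (f x) * indicator {a<..b} x \<partial>lborel) = 0"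
    by (simp add: emeasure_density)
  hence "AE x in lborel. ennreal (f x) * indicator {a<..b} x = 0"
    by (subst (asm) nn_integral_0_iff_AE) auto
  hence "AE x in lborel. x \<notin> {a<..b}"
    by eventually_elim (use pos in \<open>force simp: indicator_def split: if_splits\<close>)
  hence "emeasure lborel {a<..b} = 0"
    by (subst (asm) AE_iff_measurable[where N = "{a<..b}"]) auto
  thus False using \<open>a < b\<close> by simp
qed

lemma emeasure_density_atMost_ge_powr:
  fixes f :: "real \<Rightarrow> real"
  assumes [measurable]: "(\<lambda>x. ennreal (f x)) \<in> borel_measurable borel"
    and f_ge: "\<And>y. 0 < y \<Longrightarrow> y \<le> x \<Longrightarrow> f y \<ge> a * y powr (\<alpha> - 1)"
    and "a \<ge> 0" "\<alpha> > 0" "x > 0"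
  shows "emeasure (density lborel (\<lambda>x. ennreal (f x))) {..x} \<ge> ennreal (a / \<alpha> * x powr \<alpha>)"
proof -
  have "ennreal (a / \<alpha> * x powr \<alpha>) = 
    (\<integral>\<^sup>+y. ennreal a * (ennreal (y powr (\<alpha> - 1)) * indicator {0..x} y) \<partial>lborel)"
    using assms by (subst nn_integral_cmult) (auto simp: nn_integral_powr_from_0 simp flip: ennreal_mult')
  also have "\<dots> \<le> (\<integral>\<^sup>+y. ennreal (f y) * indicator {..x} y \<partial>lborel)"
  proof (rule nn_integral_mono)
    fix y
    show "ennreal a * (ennreal (y powr (\<alpha> - 1)) * indicator {0..x} y) \<le> ennreal (f y) * indicator {..x} y"
      using f_ge[of y] \<open>a \<ge> 0\<close>
      \<comment> \<open>At \<open>y = 0\<close> the hypothesis \<open>f_ge\<close> says nothing, but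
        the left-hand side vanishes because \<open>0 powr _ = 0\<close>.\<close>
      by (cases "y = 0") (auto simp: indicator_def simp flip: ennreal_mult' intro!: ennreal_leI)
  qed
  finally show ?thesis by (simp add: emeasure_density)
qed

text \<open>Only the mass of the unit interval above \<open>x\<close> is kept, where the exponential
  is smallest at the right end. The shift from \<open>x\<close> to \<open>x + 1\<close> does not
  affect the leading order of the exponent.\<close>

lemma emeasure_density_greaterThan_ge_exp:
  fixes f :: "real \<Rightarrow> real"
  assumes [measurable]: "(\<lambda>x. ennreal (f x)) \<in> borel_measurable borel"
    and f_ge: "\<And>y. y > x \<Longrightarrow> f y \<ge> exp (- c * y powr \<beta>)"
    and "c \<ge> 0" "\<beta> > 0" "x > 0"
  shows "emeasure (density lborel (\<lambda>x. ennreal (f x))) {x<..} \<ge> ennreal (exp (- c * (x + 1) powr \<beta>))"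
proof -
  have "ennreal (exp (- c * (x + 1) powr \<beta>)) = 
    (\<integral>\<^sup>+y. ennreal (exp (- c * (x + 1) powr \<beta>)) * indicator {x<..x+1} y \<partial>lborel)"
    by (subst nn_integral_cmult_indicator) auto
  also have "\<dots> \<le> (\<integral>\<^sup>+y. ennreal (f y) * indicator {x<..} y \<partial>lborel)"
  proof (rule nn_integral_mono)
    fix y
    have "exp (- c * (x + 1) powr \<beta>) \<le> f y" if "x < y" "y \<le> x + 1"
    proof -
      have "exp (- c * (x + 1) powr \<beta>) \<le> exp (- c * y powr \<beta>)"
        using that assms by (auto intro!: mult_left_mono powr_mono2)
      also have "\<dots> \<le> f y" using that f_ge by blast
      finally show ?thesis .
    qed
    thus "ennreal (exp (- c * (x + 1) powr \<beta>)) * indicator {x<..x+1} y \<le> ennreal (f y) * indicator {x<..} y"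
      by (auto simp: indicator_def intro!: ennreal_leI)
  qed
  finally show ?thesis by (simp add: emeasure_density)
qed

section \<open>Consequences of the assumed equality in distribution\<close>

text \<open>The assumption to be refuted is part of the context, with \<open>C\<close> of unknown
  sign. The two limits of \<open>f\<close> are kept out, so that each estimate below takes only the
  one at its own end of the half-line.\<close>

locale iid_sum_eq_scaled_max = prob_space M for M :: "'a measure" +
  fixes X :: "'i \<Rightarrow> 'a \<Rightarrow> real" and I :: "'i set" and f :: "real \<Rightarrow> real" and C :: real
  assumes finite: "finite I" and nonempty: "I \<noteq> {}"
    and indep: "indep_vars (\<lambda>_. borel) X I"
    and distr_X: "\<And>i. i \<in> I \<Longrightarrow> distr M borel (X i) = density lborel (\<lambda>x. ennreal (f x))"
    and X_pos: "\<And>i. i \<in> I \<Longrightarrow> AE \<omega> in M. X i \<omega> > 0"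
    and f_measurable [measurable]: "(\<lambda>x. ennreal (f x)) \<in> borel_measurable borel"
    and f_pos: "\<And>x. x > 0 \<Longrightarrow> f x > 0"
    and f_zero: "\<And>x. x \<le> 0 \<Longrightarrow> f x = 0"
    and sum_eq_max: "distr M borel (\<lambda>\<omega>. \<Sum>i\<in>I. X i \<omega>) = distr M borel (\<lambda>\<omega>. C * (MAX i\<in>I. X i \<omega>))"
begin

lemma X_measurable [measurable]: "i \<in> I \<Longrightarrow> X i \<in> borel_measurable M"
  using indep by (auto simp: indep_vars_def2)

lemma Max_measurable [measurable]: "(\<lambda>\<omega>. MAX i\<in>I. X i \<omega>) \<in> borel_measurable M"
  using finite nonempty by (intro borel_measurable_Max) auto

lemma emeasure_X:
  assumes "i \<in> I" "A \<in> sets borel"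
  shows "emeasure M {\<omega>\<in>space M. X i \<omega> \<in> A} = emeasure (density lborel (\<lambda>x. ennreal (f x))) A"
  unfolding distr_X[OF assms(1), symmetric] using assms
  by (subst emeasure_distr) (auto intro!: arg_cong[where f = "emeasure M"])

lemma emeasure_all_X:
  assumes A[measurable]: "A \<in> sets borel"
  shows "emeasure M {\<omega>\<in>space M. \<forall>i\<in>I. X i \<omega> \<in> A}
    = emeasure (density lborel (\<lambda>x. ennreal (f x))) A ^ card I"
proof -
  have "{\<omega>\<in>space M. \<forall>i\<in>I. X i \<omega> \<in> A} = (\<Inter>i\<in>I. X i -` A \<inter> space M)"
    using nonempty by auto
  hence "emeasure M {\<omega>\<in>space M. \<forall>i\<in>I. X i \<omega> \<in> A} = ennreal (\<Prod>i\<in>I. prob (X i -` A \<inter> space M))"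
    using indep_varsD[OF indep nonempty finite order.refl, of "\<lambda>_. A"] by (simp add: emeasure_eq_measure)
  also have "\<dots> = (\<Prod>i\<in>I. emeasure M (X i -` A \<inter> space M))"
    by (simp add: prod_ennreal emeasure_eq_measure)
  also have "\<dots> = (\<Prod>i\<in>I. emeasure (density lborel (\<lambda>x. ennreal (f x))) A)"
    by (intro prod.cong refl) (simp add: emeasure_X[symmetric] vimage_def Int_def conj_commute)
  finally show ?thesis by simp
qed

lemma emeasure_sum_eq_max:
  assumes [measurable]: "A \<in> sets borel"
  shows "emeasure M {\<omega>\<in>space M. (\<Sum>i\<in>I. X i \<omega>) \<in> A} = 
         emeasure M {\<omega>\<in>space M. C * (MAX i\<in>I. X i \<omega>) \<in> A}"
  using arg_cong[OF sum_eq_max, of "\<lambda>D. emeasure D A"]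
  by (subst (asm) (1 2) emeasure_distr) (auto simp: vimage_def Int_def conj_commute)

lemma AE_all_pos: "AE \<omega> in M. \<forall>i\<in>I. X i \<omega> > 0"
  using finite X_pos by (intro AE_finite_allI) auto

text \<open>
  If \<open>C \<le> 1\<close>, then the sum is at most 1 with probability at least that of the maximum being
  at most 1; but the event that all variables lie in \<open>(1/2, 1]\<close> is lost.
\<close>
lemma scale_gt_1:
  assumes card: "card I \<ge> 2"
  shows "C > 1"
proof (rule ccontr)
  assume "\<not> C > 1"
  define S where "S = {\<omega>\<in>space M. (\<Sum>i\<in>I. X i \<omega>) \<le> 1}"
  define A where "A = {\<omega>\<in>space M. \<forall>i\<in>I. X i \<omega> \<in> {..1}}"
  define B where "B = {\<omega>\<in>space M. \<forall>i\<in>I. X i \<omega> \<in> {1/2<..1}}"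
  have [measurable]: "S \<in> events" "A \<in> events" "B \<in> events" 
    unfolding S_def A_def B_def using finite by measurable
  have "emeasure (density lborel (\<lambda>x. ennreal (f x))) {1/2<..1} \<noteq> 0"
    using emeasure_density_Ioc_pos[of f "1/2" 1] f_pos by fastforce
  hence "emeasure M B \<noteq> 0"
    unfolding B_def by (subst emeasure_all_X) (auto intro: power_not_zero)
  hence "prob B > 0" by (simp add: emeasure_eq_measure zero_less_measure_iff)
  have "B \<subseteq> A" by (auto simp: A_def B_def)
  have "AE \<omega> in M. \<omega> \<in> S \<longrightarrow> \<omega> \<in> A - B"
    using AE_all_pos
  proof eventually_elim
    case (elim \<omega>)
    show ?case
    proof
      assume "\<omega> \<in> S"
      have "X i \<omega> \<le> 1" if "i \<in> I" for i
      proof -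
        have "X i \<omega> \<le> (\<Sum>i\<in>I. X i \<omega>)" using elim that finite by (intro member_le_sum) (auto intro: less_imp_le)
        thus ?thesis using \<open>\<omega> \<in> S\<close> by (simp add: S_def)
      qed
      moreover have "\<omega> \<notin> B"
      proof
        assume "\<omega> \<in> B"
        have "1 \<le> (\<Sum>i\<in>I. 1/2::real)" using card by simp
        also have "\<dots> < (\<Sum>i\<in>I. X i \<omega>)"
          using \<open>\<omega> \<in> B\<close> finite nonempty by (intro sum_strict_mono) (auto simp: B_def)
        finally show False using \<open>\<omega> \<in> S\<close> by (simp add: S_def)
      qed
      ultimately show "\<omega> \<in> A - B" using \<open>\<omega> \<in> S\<close> by (auto simp: A_def S_def)
    qed
  qed
  hence "prob S \<le> prob (A - B)" by (intro finite_measure_mono_AE) auto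
  also have "\<dots> = prob A - prob B" using \<open>B \<subseteq> A\<close> by (intro finite_measure_Diff) auto
  also have "\<dots> < prob A" using \<open>prob B > 0\<close> by simp
  also have "prob A \<le> prob {\<omega>\<in>space M. C * (MAX i\<in>I. X i \<omega>) \<in> {..1}}"
  proof (rule finite_measure_mono_AE)
    show "AE \<omega> in M. \<omega> \<in> A \<longrightarrow> \<omega> \<in> {\<omega>\<in>space M. C * (MAX i\<in>I. X i \<omega>) \<in> {..1}}"
      using AE_all_pos
    proof eventually_elim
      case (elim \<omega>)
      show ?case
      proof
        assume "\<omega> \<in> A"
        have "(MAX i\<in>I. X i \<omega>) \<in> (\<lambda>i. X i \<omega>) ` I" using finite nonempty by (intro Max_in) auto
        then obtain j where "j \<in> I" "(MAX i\<in>I. X i \<omega>) = X j \<omega>" by auto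
        \<comment> \<open>Positivity of \<open>X j \<omega>\<close> makes this hold for every
          \<open>C \<le> 1\<close>, including negative \<open>C\<close>.\<close>
        moreover from this have "C * X j \<omega> \<le> 1 * X j \<omega>"
          using elim \<open>\<not> C > 1\<close> by (intro mult_right_mono) (auto intro: less_imp_le)
        ultimately show "\<omega> \<in> {\<omega>\<in>space M. C * (MAX i\<in>I. X i \<omega>) \<in> {..1}}" 
          using \<open>\<omega> \<in> A\<close> by (force simp: A_def)
      qed
    qed
  qed measurable
  also have "\<dots> = prob S"
    using emeasure_sum_eq_max[of "{..1}"] by (simp add: measure_def S_def)
  finally show False by simp
qed

text \<open>The probability that the scaled maximum is at most \<open>x\<close> is an
  \<open>n\<close>-th power, bounded below through \<open>a\<close>. The same probability for the
  sum is bounded above by the Dirichlet estimate through \<open>b\<close>. Both bounds are multiples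
  of \<open>x powr (n * \<alpha>)\<close>, so a single small \<open>x\<close> suffices and
  cancels.\<close>

lemma Gamma_le_scale:
  assumes "C > 0" "a > 0" "b > 0" "\<alpha> > 0" "\<delta> > 0"
    and f_ge: "\<And>x. 0 < x \<Longrightarrow> x \<le> \<delta> \<Longrightarrow> f x \<ge> a * x powr (\<alpha> - 1)"
    and f_le: "\<And>x. 0 < x \<Longrightarrow> x \<le> \<delta> \<Longrightarrow> f x \<le> b * x powr (\<alpha> - 1)"
  shows "a ^ card I * Gamma (real (card I) * \<alpha> + 1) \<le> (b * (Gamma (\<alpha> + 1) * C powr \<alpha>)) ^ card I"
proof -
  define n where "n = card I"
  \<comment> \<open>Both \<open>x\<close> and \<open>x / C\<close> must lie in the range where
    \<open>f\<close> is controlled.\<close>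
  define x where "x = min \<delta> (C * \<delta>)"
  have x: "0 < x" "x \<le> \<delta>" "x / C \<le> \<delta>" using assms by (auto simp: x_def field_simps)
  have "n * \<alpha> \<ge> 0" using assms by simp
  hence Gam: "Gamma (n * \<alpha> + 1) > 0" by (intro Gamma_real_pos) linarith
  have scale: "C * m \<le> x \<longleftrightarrow> m \<le> x / C" for m
    using \<open>C > 0\<close> by (simp add: field_simps)
  have base_nonneg: "a / \<alpha> * (x / C) powr \<alpha> \<ge> 0" using assms by simp
  have "ennreal ((a / \<alpha> * (x / C) powr \<alpha>) ^ n) \<le> emeasure (density lborel (\<lambda>x. ennreal (f x))) {..x / C} ^ n"
    unfolding ennreal_power[symmetric, OF base_nonneg] using assms x
    by (intro power_mono emeasure_density_atMost_ge_powr f_ge) auto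
  also have "\<dots> = emeasure M {\<omega>\<in>space M. \<forall>i\<in>I. X i \<omega> \<in> {..x / C}}"
    unfolding n_def by (intro emeasure_all_X[symmetric]) auto
  also have "\<dots> = emeasure M {\<omega>\<in>space M. C * (MAX i\<in>I. X i \<omega>) \<in> {..x}}"
    using finite nonempty by (simp add: scale)
  also have "\<dots> = emeasure M {\<omega>\<in>space M. (\<Sum>i\<in>I. X i \<omega>) \<in> {..x}}"
    by (intro emeasure_sum_eq_max[symmetric]) auto
  also have "\<dots> \<le> ennreal ((b * Gamma \<alpha>) ^ n / Gamma (n * \<alpha> + 1) * x powr (n * \<alpha>))"
    unfolding n_def atMost_iff using assms x
    by (intro emeasure_sum_le_powr[where f = f] finite indep distr_X X_pos f_zero f_le) auto
  finally have *: "(a / \<alpha> * (x / C) powr \<alpha>) ^ n \<le> (b * Gamma \<alpha>) ^ n / Gamma (n * \<alpha> + 1) * x powr (n * \<alpha>)"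
    using assms Gam by (subst (asm) ennreal_le_iff) auto
  have 1: "(a / \<alpha> * (x / C) powr \<alpha>) ^ n = x powr (n * \<alpha>) * (a ^ n / (\<alpha> * C powr \<alpha>) ^ n)"
  proof -
    have "x powr (n * \<alpha>) = (x powr \<alpha>) ^ n" using x by (simp add: powr_powr powr_realpow[symmetric] mult.commute)
    thus ?thesis using x \<open>C > 0\<close> by (simp add: powr_divide power_mult_distrib power_divide)
  qed
  from * have "a ^ n / (\<alpha> * C powr \<alpha>) ^ n \<le> (b * Gamma \<alpha>) ^ n / Gamma (n * \<alpha> + 1)"
    unfolding 1 mult.commute[of _ "x powr (n * \<alpha>)"] using x
    by (subst (asm) mult_le_cancel_left_pos) auto
  hence "a ^ n * Gamma (n * \<alpha> + 1) \<le> (b * Gamma \<alpha>) ^ n * (\<alpha> * C powr \<alpha>) ^ n"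
    using Gam assms by (simp add: field_simps)
  also have "\<dots> = (b * (Gamma (\<alpha> + 1) * C powr \<alpha>)) ^ n"
    using Gamma_plus1[of \<alpha>] \<open>\<alpha> > 0\<close> by (force simp: power_mult_distrib mult_ac elim!: nonpos_Ints_cases)
  finally show ?thesis by (simp add: n_def)
qed

text \<open>Take \<open>a = c - \<epsilon>\<close> and \<open>b = c + \<epsilon>\<close> in
  \<open>Gamma_le_scale\<close> and let \<epsilon> tend to 0. The powers of \<open>c\<close> cancel;
  taking logarithms and dividing by \<open>n * \<alpha>\<close> produces
  \<open>h_fun\<close>.\<close>

lemma h_fun_le_ln_scale:
  assumes "C > 0" "c > 0" "\<alpha> > 0" and lim: "((\<lambda>x. f x / x powr (\<alpha> - 1)) \<longlongrightarrow> c) (at_right 0)"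
  shows "h_fun (real (card I) * \<alpha>) \<le> h_fun \<alpha> + ln C"
proof -
  define n where "n = card I"
  define G where "G = Gamma (real n * \<alpha> + 1)"
  have "n > 0" using finite nonempty by (simp add: n_def card_gt_0_iff)
  have G: "G > 0" "Gamma (\<alpha> + 1) > 0" 
    unfolding G_def using assms by (auto intro!: Gamma_real_pos add_nonneg_pos)
  have le: "(c - \<epsilon>) ^ n * G \<le> ((c + \<epsilon>) * (Gamma (\<alpha> + 1) * C powr \<alpha>)) ^ n" if \<epsilon>: "0 < \<epsilon>" "\<epsilon> < c" for \<epsilon>
  proof -
    have "eventually (\<lambda>x. dist (f x / x powr (\<alpha> - 1)) c < \<epsilon>) (at_right 0)"
      using lim \<epsilon> by (auto simp: tendsto_iff)
    then obtain d where d: "d > 0" "\<And>x. 0 < x \<Longrightarrow> x < d \<Longrightarrow> dist (f x / x powr (\<alpha> - 1)) c < \<epsilon>"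
      by (auto simp: eventually_at_right_field)
    \<comment> \<open>Halving \<open>d\<close> turns the open range from the limit into the closed
      one that \<open>Gamma_le_scale\<close> expects.\<close>
    have "(c - \<epsilon>) * x powr (\<alpha> - 1) \<le> f x" "f x \<le> (c + \<epsilon>) * x powr (\<alpha> - 1)" if "0 < x" "x \<le> d / 2" for x
    proof -
      have "f x / x powr (\<alpha> - 1) > c - \<epsilon>" "f x / x powr (\<alpha> - 1) < c + \<epsilon>"
        using d(1) d(2)[of x] that by (auto simp: dist_real_def abs_less_iff)
      thus "(c - \<epsilon>) * x powr (\<alpha> - 1) \<le> f x" "f x \<le> (c + \<epsilon>) * x powr (\<alpha> - 1)"
        using that by (auto simp: field_simps)
    qed
    thus ?thesis unfolding n_def G_def
      using \<epsilon> assms d by (intro Gamma_le_scale[where \<delta> = "d / 2"]) auto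
  qed
  have "(c - 0) ^ n * G \<le> ((c + 0) * (Gamma (\<alpha> + 1) * C powr \<alpha>)) ^ n"
  proof (rule tendsto_le)
    show "((\<lambda>\<epsilon>. (c - \<epsilon>) ^ n * G) \<longlongrightarrow> (c - 0) ^ n * G) (at_right 0)"
      by (intro tendsto_intros)
    show "((\<lambda>\<epsilon>. ((c + \<epsilon>) * (Gamma (\<alpha> + 1) * C powr \<alpha>)) ^ n) \<longlongrightarrow> 
            ((c + 0) * (Gamma (\<alpha> + 1) * C powr \<alpha>)) ^ n) (at_right 0)"
      by (intro tendsto_intros)
    show "eventually (\<lambda>\<epsilon>. (c - \<epsilon>) ^ n * G \<le> ((c + \<epsilon>) * (Gamma (\<alpha> + 1) * C powr \<alpha>)) ^ n) (at_right 0)"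
      using eventually_at_right_less[of 0] eventually_at_right_real[OF \<open>c > 0\<close>]
      by eventually_elim (use le in auto)
  qed auto
  hence "G \<le> (Gamma (\<alpha> + 1) * C powr \<alpha>) ^ n" using \<open>c > 0\<close> by (simp add: power_mult_distrib)
  hence "ln G \<le> ln ((Gamma (\<alpha> + 1) * C powr \<alpha>) ^ n)" using G \<open>C > 0\<close> by (subst ln_le_cancel_iff) auto
  also have "\<dots> = n * (ln (Gamma (\<alpha> + 1)) + \<alpha> * ln C)"
    using G \<open>C > 0\<close> by (simp add: ln_realpow ln_mult ln_powr)
  finally show ?thesis
    using \<open>n > 0\<close> \<open>\<alpha> > 0\<close> by (simp add: h_fun_def G_def n_def[symmetric] field_simps)
qed

text \<open>If the sum exceeds \<open>x\<close>, then the sum of the \<beta>-th powers is at least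
  \<open>q * x powr \<beta>\<close>, which Chernoff makes exponentially unlikely. The scaled maximum
  exceeds \<open>x\<close> as soon as one variable exceeds \<open>x / C\<close>. Comparing exponents
  at scale \<open>x powr \<beta>\<close>, first as \<open>x\<close> tends to infinity and then as
  \<epsilon> tends to 0, gives the claim. Leaving \<open>q\<close> abstract serves both ranges of
  \<beta>.\<close>

lemma scale_powr_ge:
  assumes "C > 0" "c > 0" "\<beta> > 0" "q > 0"
    and lim: "((\<lambda>x. - ln (f x) / x powr \<beta>) \<longlongrightarrow> c) at_top"
    and q: "\<And>x :: 'i \<Rightarrow> real. (\<And>i. i \<in> I \<Longrightarrow> x i > 0) \<Longrightarrow> q * (\<Sum>i\<in>I. x i) powr \<beta> \<le> (\<Sum>i\<in>I. x i powr \<beta>)"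
  shows "q \<le> C powr (-\<beta>)"
proof -
  have le: "(c - 2 * \<epsilon>) * q \<le> (c + \<epsilon>) * C powr (-\<beta>)" if \<epsilon>: "0 < \<epsilon>" "\<epsilon> < c / 2" for \<epsilon>
  proof -
    \<comment> \<open>The density is only known to decay at rate \<open>c - \<epsilon>\<close>, so
      the Chernoff parameter stays strictly below that to have a finite moment;
      \<open>\<epsilon> < c / 2\<close> keeps it positive.\<close>
    define s where "s = c - 2 * \<epsilon>"
    have "s > 0" using \<epsilon> by (simp add: s_def)
    have "eventually (\<lambda>x. dist (- ln (f x) / x powr \<beta>) c < \<epsilon>) at_top"
      using lim \<epsilon> by (auto simp: tendsto_iff)
    hence "eventually (\<lambda>x. exp (- (c + \<epsilon>) * x powr \<beta>) \<le> f x \<and> f x \<le> exp (- (c - \<epsilon>) * x powr \<beta>)) at_top"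
      using eventually_gt_at_top[of 0]
    proof eventually_elim
      case (elim x)
      hence "- ln (f x) / x powr \<beta> > c - \<epsilon>" "- ln (f x) / x powr \<beta> < c + \<epsilon>"
        by (auto simp: dist_real_def abs_less_iff)
      hence "- (c + \<epsilon>) * x powr \<beta> \<le> ln (f x)" "ln (f x) \<le> - (c - \<epsilon>) * x powr \<beta>"
        using elim by (auto simp: field_simps)
      moreover have "f x = exp (ln (f x))" using f_pos[of x] elim by simp
      ultimately show ?case by (metis exp_le_cancel_iff)
    qed
    then obtain b where b: "\<And>x. x \<ge> b \<Longrightarrow> exp (- (c + \<epsilon>) * x powr \<beta>) \<le> f x"
      and b': "\<And>x. x \<ge> b \<Longrightarrow> f x \<le> exp (- (c - \<epsilon>) * x powr \<beta>)"
      by (auto simp: eventually_at_top_linorder)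
    obtain i0 where i0: "i0 \<in> I" using nonempty by blast

    define K where "K = (\<integral>\<^sup>+x. ennreal (f x) * ennreal (exp (s * x powr \<beta>)) \<partial>lborel)"
    have "(\<integral>\<^sup>+x. ennreal (f x) \<partial>lborel) = emeasure (density lborel (\<lambda>x. ennreal (f x))) UNIV"
      by (simp add: emeasure_density)
    also have "\<dots> < \<infinity>"
      using emeasure_X[OF i0, of UNIV] by (simp add: emeasure_space_1 flip: emeasure_X[OF i0])
    finally have "K < \<infinity>" unfolding K_def using b' \<open>s > 0\<close> \<epsilon> \<open>\<beta> > 0\<close>
      by (intro nn_integral_exp_powr_less_top[where c = "c - \<epsilon>"] f_zero f_measurable)
         (auto simp: s_def eventually_at_top_linorder)
    have K: "(\<integral>\<^sup>+\<omega>. ennreal (exp (s * X i \<omega> powr \<beta>)) \<partial>M) = K" if "i \<in> I" for i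
    proof -
      have "(\<integral>\<^sup>+\<omega>. ennreal (exp (s * X i \<omega> powr \<beta>)) \<partial>M) = 
        (\<integral>\<^sup>+x. ennreal (exp (s * x powr \<beta>)) \<partial>distr M borel (X i))"
        using that by (subst nn_integral_distr) auto
      also have "\<dots> = K" unfolding K_def distr_X[OF that] by (subst nn_integral_density) auto
      finally show ?thesis .
    qed
    \<comment> \<open>Since \<open>K\<close> is finite, the conversion to a real loses nothing;
      \<open>L\<close> does not depend on \<open>x\<close>.\<close>
    define L where "L = enn2real (K ^ card I)"
    have L: "K ^ card I = ennreal L" using \<open>K < \<infinity>\<close> by (simp add: L_def power_less_top_ennreal)
    have bound: "s * q - L / x powr \<beta> \<le> (c + \<epsilon>) * (x / C + 1) powr \<beta> / x powr \<beta>" if x: "x > 0" "x / C \<ge> b" for x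
    proof -
      have "ennreal (exp (- (c + \<epsilon>) * (x / C + 1) powr \<beta>)) 
          \<le> emeasure (density lborel (\<lambda>x. ennreal (f x))) {x / C<..}"
        using x \<epsilon> assms b by (intro emeasure_density_greaterThan_ge_exp) auto
      also have "\<dots> = emeasure M {\<omega>\<in>space M. X i0 \<omega> \<in> {x / C<..}}"
        by (intro emeasure_X[OF i0, symmetric]) auto
      also have "\<dots> \<le> emeasure M {\<omega>\<in>space M. C * (MAX i\<in>I. X i \<omega>) \<in> {x<..}}"
      proof (intro emeasure_mono subsetI; clarsimp)
        fix \<omega> assume "x / C < X i0 \<omega>"
        also have "X i0 \<omega> \<le> (MAX i\<in>I. X i \<omega>)" using i0 finite by (intro Max_ge) auto
        finally show "x < C * (MAX i\<in>I. X i \<omega>)" using \<open>C > 0\<close> by (simp add: field_simps)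
      qed
      also have "\<dots> = emeasure M {\<omega>\<in>space M. (\<Sum>i\<in>I. X i \<omega>) \<in> {x<..}}"
        by (intro emeasure_sum_eq_max[symmetric]) auto
      also have "\<dots> \<le> emeasure M {\<omega>\<in>space M. (\<Sum>i\<in>I. X i \<omega> powr \<beta>) \<ge> q * x powr \<beta>}"
      proof (intro emeasure_mono_AE)
        show "AE \<omega> in M. \<omega> \<in> {\<omega>\<in>space M. (\<Sum>i\<in>I. X i \<omega>) \<in> {x<..}} \<longrightarrow>
           \<omega> \<in> {\<omega>\<in>space M. (\<Sum>i\<in>I. X i \<omega> powr \<beta>) \<ge> q * x powr \<beta>}"
          using AE_all_pos
        proof eventually_elim
          case (elim \<omega>)
          have "q * x powr \<beta> \<le> (\<Sum>i\<in>I. X i \<omega> powr \<beta>)" if "x < (\<Sum>i\<in>I. X i \<omega>)"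
          proof -
            have "q * x powr \<beta> \<le> q * (\<Sum>i\<in>I. X i \<omega>) powr \<beta>"
              using that x assms by (intro mult_left_mono powr_mono2) auto
            also have "\<dots> \<le> (\<Sum>i\<in>I. X i \<omega> powr \<beta>)" using elim by (intro q) auto
            finally show ?thesis .
          qed
          thus ?case by auto
        qed
      qed measurable
      also have "\<dots> \<le> ennreal (exp (- s * (q * x powr \<beta>))) * 
          (\<Prod>i\<in>I. \<integral>\<^sup>+\<omega>. ennreal (exp (s * X i \<omega> powr \<beta>)) \<partial>M)"
        using \<open>s > 0\<close> by (intro emeasure_sum_ge_le_exp finite indep_vars_compose2[OF indep]) auto
      also have "(\<Prod>i\<in>I. \<integral>\<^sup>+\<omega>. ennreal (exp (s * X i \<omega> powr \<beta>)) \<partial>M) = ennreal L"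
        by (simp add: K L)
      also have "ennreal (exp (- s * (q * x powr \<beta>))) * ennreal L = ennreal (exp (- s * (q * x powr \<beta>)) * L)"
        by (simp add: ennreal_mult' L_def)
      finally have "exp (- (c + \<epsilon>) * (x / C + 1) powr \<beta>) \<le> exp (- s * (q * x powr \<beta>)) * L"
        by (subst (asm) ennreal_le_iff) (auto simp: L_def)
      \<comment> \<open>Bounding \<open>L\<close> by \<open>exp L\<close> turns the prefactor into
        an additive constant in the exponent without taking \<open>ln L\<close>. Division by
        \<open>x powr \<beta>\<close> then makes it negligible.\<close>
      also have "\<dots> \<le> exp (- s * (q * x powr \<beta>)) * exp L"
        using exp_ge_add_one_self[of L] by (intro mult_left_mono) (linarith, simp)
      also have "\<dots> = exp (L - s * q * x powr \<beta>)" by (simp flip: exp_add add: algebra_simps)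
      finally have "s * q * x powr \<beta> - L \<le> (c + \<epsilon>) * (x / C + 1) powr \<beta>"
        by (simp add: algebra_simps)
      hence "(s * q * x powr \<beta> - L) / x powr \<beta> \<le> (c + \<epsilon>) * (x / C + 1) powr \<beta> / x powr \<beta>"
        by (intro divide_right_mono) auto
      thus ?thesis using x by (simp add: diff_divide_distrib)
    qed
    have ev: "eventually (\<lambda>x. s * q - L / x powr \<beta> \<le> (c + \<epsilon>) * (x / C + 1) powr \<beta> / x powr \<beta>) at_top"
      using eventually_gt_at_top[of 0] eventually_ge_at_top[of "b * C"]
    proof eventually_elim
      case (elim x)
      thus ?case using \<open>C > 0\<close> by (intro bound) (auto simp: field_simps)
    qed
    have "((\<lambda>x. s * q - L / x powr \<beta>) \<longlongrightarrow> s * q) at_top" using \<open>\<beta> > 0\<close> by real_asymp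
    \<comment> \<open>The shift by 1 disappears in the limit.\<close>
    moreover have "((\<lambda>x. (c + \<epsilon>) * (x / C + 1) powr \<beta> / x powr \<beta>) \<longlongrightarrow> (c + \<epsilon>) * inverse C powr \<beta>) at_top"
      using \<open>\<beta> > 0\<close> \<open>C > 0\<close> by real_asymp
    ultimately have "s * q \<le> (c + \<epsilon>) * inverse C powr \<beta>"
      by (intro tendsto_le[OF _ _ _ ev]) auto
    thus ?thesis using \<open>C > 0\<close> by (simp add: s_def powr_minus powr_divide divide_inverse inverse_powr)
  qed
  have "(c - 2 * 0) * q \<le> (c + 0) * C powr (-\<beta>)"
  proof (rule tendsto_le)
    show "((\<lambda>\<epsilon>. (c - 2 * \<epsilon>) * q) \<longlongrightarrow> (c - 2 * 0) * q) (at_right 0)" by (intro tendsto_intros)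
    show "((\<lambda>\<epsilon>. (c + \<epsilon>) * C powr (-\<beta>)) \<longlongrightarrow> (c + 0) * C powr (-\<beta>)) (at_right 0)" 
      using \<open>C > 0\<close> by (intro tendsto_intros) auto
    show "eventually (\<lambda>\<epsilon>. (c - 2 * \<epsilon>) * q \<le> (c + \<epsilon>) * C powr (-\<beta>)) (at_right 0)"
      using eventually_at_right_real[of 0 "c / 2"] \<open>c > 0\<close> le by (auto elim!: eventually_mono)
  qed auto
  thus ?thesis using \<open>c > 0\<close> by simp
qed

end

section \<open>The contradiction, for \<beta> below 1 and for \<beta> at least 1\<close>

theorem theorem1p1:
  fixes M :: "'a measure" and X :: "nat \<Rightarrow> 'a \<Rightarrow> real"
    and f :: "real \<Rightarrow> real" and c\<^sub>1 c\<^sub>2 \<alpha> \<beta> :: real and n :: nat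
  assumes "prob_space M"
    and indep: "prob_space.indep_vars M (\<lambda>_. borel) X {1..}"
    and ident: "\<And>i. i \<ge> 1 \<Longrightarrow> distr M borel (X i) = distr M borel (X 1)"
    and supp: "\<And>i. i \<ge> 1 \<Longrightarrow> AE \<omega> in M. X i \<omega> > 0"
    and dens: "distributed M lborel (X 1) (\<lambda>x. ennreal (f x))"
    and f_pos: "\<And>x. x > 0 \<Longrightarrow> f x > 0"
    and f_zero: "\<And>x. x \<le> 0 \<Longrightarrow> f x = 0"
    and "c\<^sub>1 > 0" and "c\<^sub>2 > 0" and "\<alpha> > 0" and "\<beta> > 0"
    and lim_0: "((\<lambda>x. f x / x powr (\<alpha> - 1)) \<longlongrightarrow> c\<^sub>1) (at_right 0)"
    and lim_inf: "((\<lambda>x. - ln (f x) / x powr \<beta>) \<longlongrightarrow> c\<^sub>2) at_top"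
    and "n \<ge> 2"
    and beta_less: "\<beta> < ln (real n) / (ln (real n) + h_fun \<alpha> - h_fun (real n * \<alpha>))"
  shows "\<not> (\<exists>C::real.
    distr M borel (\<lambda>\<omega>. \<Sum>i=1..n. X i \<omega>) =
    distr M borel (\<lambda>\<omega>. C * (MAX i\<in>{1..n}. X i \<omega>)))"
proof
  assume "\<exists>C::real. distr M borel (\<lambda>\<omega>. \<Sum>i=1..n. X i \<omega>) =
    distr M borel (\<lambda>\<omega>. C * (MAX i\<in>{1..n}. X i \<omega>))"
  then obtain C :: real where C: "distr M borel (\<lambda>\<omega>. \<Sum>i=1..n. X i \<omega>) =
    distr M borel (\<lambda>\<omega>. C * (MAX i\<in>{1..n}. X i \<omega>))" ..
  interpret prob_space M by fact
  have f_meas: "(\<lambda>x. ennreal (f x)) \<in> borel_measurable borel"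
    using distributed_borel_measurable[OF dens] by simp
  have "distr M borel (X 1) = density lborel (\<lambda>x. ennreal (f x))"
    using distributed_distr_eq_density[OF dens] by (simp cong: distr_cong)
  hence distr_X: "distr M borel (X i) = density lborel (\<lambda>x. ennreal (f x))" if "i \<in> {1..n}" for i
    using ident[of i] that by simp
  interpret iid_sum_eq_scaled_max M X "{1..n}" f C
  proof unfold_locales
    show "indep_vars (\<lambda>_. borel) X {1..n}"
      by (rule indep_vars_subset[OF indep]) auto
  qed (use \<open>n \<ge> 2\<close> C in \<open>simp_all add: distr_X supp f_meas f_pos f_zero\<close>)
  have "C > 1" using \<open>n \<ge> 2\<close> by (intro scale_gt_1) auto
  have h: "h_fun (n * \<alpha>) \<le> h_fun \<alpha> + ln C"
    using h_fun_le_ln_scale[OF _ \<open>c\<^sub>1 > 0\<close> \<open>\<alpha> > 0\<close> lim_0] \<open>C > 1\<close> by simp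
  have "ln n > 0" using \<open>n \<ge> 2\<close> by simp
  \<comment> \<open>A nonpositive denominator would make the quotient nonpositive (division by 0
    gives 0), against \<open>0 < \<beta>\<close>. Positivity is what allows \<open>beta_less\<close>
    to be multiplied out below.\<close>
  have denom: "ln n + h_fun \<alpha> - h_fun (n * \<alpha>) > 0"
  proof (rule ccontr)
    assume "\<not> ?thesis"
    hence "ln n / (ln n + h_fun \<alpha> - h_fun (n * \<alpha>)) \<le> 0"
      using \<open>ln n > 0\<close> by (intro divide_nonneg_nonpos) auto
    thus False using beta_less \<open>\<beta> > 0\<close> by linarith
  qed
  show False
  proof (cases "\<beta> < 1")
    case True
    \<comment> \<open>This is \<open>scale_powr_ge\<close> with \<open>q = 1\<close>: a large sum
      comes from one large summand, which would force \<open>C \<le> 1\<close>.\<close>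
    have "1 \<le> C powr (-\<beta>)"
      using \<open>C > 1\<close> \<open>c\<^sub>2 > 0\<close> \<open>\<beta> > 0\<close> \<open>n \<ge> 2\<close> True powr_sum_le_sum_powr[of "{1..n}" _ \<beta>]
      by (intro scale_powr_ge[OF _ _ _ _ lim_inf]) auto
    moreover have "C powr (-\<beta>) < C powr 0" using \<open>C > 1\<close> \<open>\<beta> > 0\<close> by (intro powr_less_mono) auto
    ultimately show False using \<open>C > 1\<close> by simp
  next
    case False
    \<comment> \<open>Here \<open>q = n powr (1 - \<beta>)\<close>, the constant from Jensen's
      inequality.\<close>
    have "real n powr (1 - \<beta>) \<le> C powr (-\<beta>)"
      using \<open>C > 1\<close> \<open>c\<^sub>2 > 0\<close> \<open>\<beta> > 0\<close> \<open>n \<ge> 2\<close> False card_powr_mult_powr_sum_le_sum_powr[of "{1..n}" _ \<beta>]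
      by (intro scale_powr_ge[OF _ _ _ _ lim_inf]) auto
    hence "ln (real n powr (1 - \<beta>)) \<le> ln (C powr (-\<beta>))"
      using \<open>C > 1\<close> \<open>n \<ge> 2\<close> by (subst ln_le_cancel_iff) auto
    hence "(1 - \<beta>) * ln n \<le> - \<beta> * ln C" using \<open>C > 1\<close> \<open>n \<ge> 2\<close> by (simp add: ln_powr)
    moreover have "\<beta> * (ln n + h_fun \<alpha> - h_fun (n * \<alpha>)) < ln n"
      using beta_less denom by (simp add: field_simps)
    moreover have "\<beta> * (h_fun (n * \<alpha>) - h_fun \<alpha>) \<le> \<beta> * ln C"
      using h \<open>\<beta> > 0\<close> by (intro mult_left_mono) auto
    \<comment> \<open>The first and third facts give \<open>\<beta> * (h_fun (n * \<alpha>) - h_fun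
      \<alpha>) \<le> (\<beta> - 1) * ln n\<close>, the negation of the second.\<close>
    ultimately show False by (simp add: algebra_simps)
  qed
qed

end
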